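(* Let $H$ be a complex Hilbert space. Then for every $T\in L(H)$ the following statements hold: (i) $\sigma_{dsc}(R_T)=\overline{\sigma_{dsc}(L_{T^*})}=\overline{\sigma_{dsc}(T^* )}$ and $\sigma_{dsc}(R_{T^*})=\overline{\sigma_{dsc}(L_T)}=\overline{\sigma_{dsc}(T)}$; (ii) $\sigma_{asc}(R_T)=\overline{\sigma_{asc}(L_{T^*})}=\overline{\sigma_{asc}(T^* )}$ and $\sigma_{asc}(R_{T^*})=\overline{\sigma_{asc}(L_T)}=\overline{\sigma_{asc}(T)}$. Furthermore, when $T=T^*$, $\sigma_{dsc}(R_T)$ and $\sigma_{asc}(R_T)$ are subsets of the real line, and (iii) $\sigma_{asc}(R_T)=\sigma_{asc}(L_T)=\sigma_{asc}(T)$; (iv) $\sigma_{\mathcal{DR}}(T)=\sigma_{dsc}(R_T)=\sigma_{dsc}(L_T)=\sigma_{dsc}(T)$.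
   Context: $L(H)$ is the algebra of bounded linear operators on $H$, and $T^*$ is the Hilbert space adjoint of $T$. For $T\in L(H)$, $L_T,R_T\in L(L(H))$ are the multiplication operators $L_T(S)=TS$, $R_T(S)=ST$. For $K\subseteq\mathbb C$, $\overline{K}=\{\overline{\alpha}:\alpha\in K\}$ denotes the set of complex conjugates (not the closure). For a Banach space $X$ and a bounded linear operator $U$ on $X$, with null space $N(U)$ and range $R(U)$, the descent and the ascent are $d(U)=\inf\{n\ge 0: R(U^n)=R(U^{n+1})\}$ and $a(U)=\inf\{n\ge 0: N(U^n)=N(U^{n+1})\}$, with $\inf\emptyset=\infty$. The descent and ascent spectra are $\sigma_{dsc}(U)=\{\lambda\in\mathbb C: d(U-\lambda)=\infty\}$ and $\sigma_{asc}(U)=\{\lambda\in\mathbb C: a(U-\lambda)=\infty\}$. An element $a$ of a unital Banach algebra $A$ is Drazin invertible if there exist $b\in A$ and $m\in\mathbb N$ such that $a^mba=a^m$, $bab=b$ and $ab=ba$; the Drazin spectrum is $\sigma_{\mathcal{DR}}(a)=\{\lambda\in\mathbb C: a-\lambda \text{ is not Drazin invertible in } A\}$ (here used with $A=L(H)$). *)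

theory Defs
  imports "HOL-Analysis.Analysis" "HOL-Library.Extended_Nat"
begin

section \<open>Complex Banach and Hilbert spaces\<close>

class complex_normed_vector = real_normed_vector +
  fixes scaleC :: "complex \<Rightarrow> 'a \<Rightarrow> 'a"  (infixr "*\<^sub>C" 75)
  assumes scaleR_scaleC: "r *\<^sub>R x = complex_of_real r *\<^sub>C x"
    and scaleC_add_right: "c *\<^sub>C (x + y) = c *\<^sub>C x + c *\<^sub>C y"
    and scaleC_add_left: "(c + d) *\<^sub>C x = c *\<^sub>C x + d *\<^sub>C x"
    and scaleC_scaleC: "c *\<^sub>C (d *\<^sub>C x) = (c * d) *\<^sub>C x"
    and norm_scaleC: "norm (c *\<^sub>C x) = cmod c * norm x"

class complex_banach = complex_normed_vector + banach

text \<open>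
  The inner product is linear in the first argument. As the norm axiom forces
  \<open>cinner x x\<close> to be real and nonnegative, and zero only for \<open>x = 0\<close>,
  positive definiteness is not listed separately.
\<close>

class complex_hilbert_space = complex_banach +
  fixes cinner :: "'a \<Rightarrow> 'a \<Rightarrow> complex"
  assumes cinner_commute: "cinner x y = cnj (cinner y x)"
    and cinner_add_left: "cinner (x + y) z = cinner x z + cinner y z"
    and cinner_scaleC_left: "cinner (c *\<^sub>C x) y = c * cinner x y"
    and cinner_norm: "cinner x x = complex_of_real ((norm x)\<^sup>2)"

text \<open>
  Unital complex Banach algebras. The library's classes for unital rings demand
  \<open>0 \<noteq> 1\<close>, which fails for the operators on the zero space; therefore
  the unit is supplied by \<^class>\<open>monoid_mult\<close>, and \<open>norm 1 = 1\<close> is not required.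
\<close>

class complex_banach_algebra = complex_banach + real_normed_algebra + monoid_mult +
  assumes mult_scaleC_left: "(c *\<^sub>C x) * y = c *\<^sub>C (x * y)"
    and mult_scaleC_right: "x * (c *\<^sub>C y) = c *\<^sub>C (x * y)"

lemma scaleC_one [simp]: "1 *\<^sub>C (x :: 'a :: complex_normed_vector) = x"
  using scaleR_scaleC[of 1 x] by simp

lemma scaleC_zero_right [simp]: "c *\<^sub>C (0 :: 'a :: complex_normed_vector) = 0"
  using scaleC_add_right[of c "0 :: 'a" 0] by simp

lemma bounded_linear_scaleC: "bounded_linear ((*\<^sub>C) c :: 'a :: complex_normed_vector \<Rightarrow> 'a)"
  by (rule bounded_linear_intro[where K = "cmod c"])
    (simp_all add: scaleC_add_right scaleR_scaleC scaleC_scaleC norm_scaleC mult.commute)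

lemma scaleC_minus_right: "c *\<^sub>C (- x) = - (c *\<^sub>C (x :: 'a :: complex_normed_vector))"
  using linear_neg[OF bounded_linear.linear[OF bounded_linear_scaleC]] .

lemma scaleC_diff_right: "c *\<^sub>C (x - y) = c *\<^sub>C x - c *\<^sub>C (y :: 'a :: complex_normed_vector)"
  using linear_diff[OF bounded_linear.linear[OF bounded_linear_scaleC]] .

lemma scaleC_scaleR: "c *\<^sub>C (r *\<^sub>R x) = r *\<^sub>R (c *\<^sub>C (x :: 'a :: complex_normed_vector))"
  using linear_scale[OF bounded_linear.linear[OF bounded_linear_scaleC]] .


section \<open>The Banach algebra of bounded operators on a complex Banach space\<close>

typedef (overloaded) 'a bounded_op =
  "{T :: 'a :: complex_normed_vector \<Rightarrow>\<^sub>L 'a.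
      \<forall>c x. blinfun_apply T (c *\<^sub>C x) = c *\<^sub>C blinfun_apply T x}"
  morphisms blinfun_of_op op_of_blinfun
  by (intro exI[of _ 0]) simp

setup_lifting type_definition_bounded_op

lift_definition op_apply :: "'a :: complex_normed_vector bounded_op \<Rightarrow> 'a \<Rightarrow> 'a"
  is blinfun_apply .

lemma op_eqI: "(\<And>x. op_apply S x = op_apply T x) \<Longrightarrow> S = T"
  by transfer (rule blinfun_eqI)

lemma op_apply_scaleC: "op_apply T (c *\<^sub>C x) = c *\<^sub>C op_apply T x"
  by transfer simp

lemma bounded_linear_op_apply: "bounded_linear (op_apply T)"
  by transfer (rule blinfun.bounded_linear_right)

instantiation bounded_op :: (complex_normed_vector) complex_normed_vector
begin

lift_definition zero_bounded_op :: "'a bounded_op" is 0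
  by simp

lift_definition plus_bounded_op :: "'a bounded_op \<Rightarrow> 'a bounded_op \<Rightarrow> 'a bounded_op" is "(+)"
  by (simp add: blinfun.add_left scaleC_add_right)

lift_definition uminus_bounded_op :: "'a bounded_op \<Rightarrow> 'a bounded_op" is uminus
  by (simp add: blinfun.minus_left scaleC_minus_right)

lift_definition minus_bounded_op :: "'a bounded_op \<Rightarrow> 'a bounded_op \<Rightarrow> 'a bounded_op" is "(-)"
  by (simp add: blinfun.diff_left scaleC_diff_right)

lift_definition scaleR_bounded_op :: "real \<Rightarrow> 'a bounded_op \<Rightarrow> 'a bounded_op" is "(*\<^sub>R)"
  by (simp add: blinfun.scaleR_left scaleC_scaleR)

lift_definition scaleC_bounded_op :: "complex \<Rightarrow> 'a bounded_op \<Rightarrow> 'a bounded_op"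
  is "\<lambda>c T. blinfun_compose (Blinfun ((*\<^sub>C) c)) T"
  by (simp add: bounded_linear_Blinfun_apply[OF bounded_linear_scaleC] scaleC_scaleC mult.commute)

lift_definition norm_bounded_op :: "'a bounded_op \<Rightarrow> real" is norm .

lift_definition dist_bounded_op :: "'a bounded_op \<Rightarrow> 'a bounded_op \<Rightarrow> real" is dist .

lift_definition sgn_bounded_op :: "'a bounded_op \<Rightarrow> 'a bounded_op" is sgn
  by (simp add: sgn_div_norm blinfun.scaleR_left scaleC_scaleR)

definition uniformity_bounded_op :: "('a bounded_op \<times> 'a bounded_op) filter" where
  [code del]: "uniformity_bounded_op = (INF e\<in>{0 <..}. principal {(x, y). dist x y < e})"

definition open_bounded_op :: "'a bounded_op set \<Rightarrow> bool" where
  [code del]: "open_bounded_op S = (\<forall>x\<in>S. \<forall>\<^sub>F (x', y) in uniformity. x' = x \<longrightarrow> y \<in> S)"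

lemma op_apply_scaleC_left: "op_apply (c *\<^sub>C T) x = c *\<^sub>C op_apply T x"
  by transfer (simp add: bounded_linear_Blinfun_apply[OF bounded_linear_scaleC])

lemma op_apply_add_left: "op_apply (S + T) x = op_apply S x + op_apply T x"
  by transfer (simp add: blinfun.add_left)

lemma op_apply_scaleR_left: "op_apply (r *\<^sub>R T) x = r *\<^sub>R op_apply T x"
  by transfer (simp add: blinfun.scaleR_left)

lemma norm_op_le: "norm (c *\<^sub>C T) \<le> cmod c * norm (T :: 'a bounded_op)"
proof transfer
  fix c and T :: "'a \<Rightarrow>\<^sub>L 'a"
  show "norm (blinfun_compose (Blinfun ((*\<^sub>C) c)) T) \<le> cmod c * norm T"
    by (rule norm_blinfun_bound)
      (auto simp: bounded_linear_Blinfun_apply[OF bounded_linear_scaleC] norm_scaleC mult.assoc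
        intro!: mult_left_mono norm_blinfun)
qed

instance
proof
  fix S T U :: "'a bounded_op" and r s :: real and c d :: complex
  show "S + T + U = S + (T + U)" "S + T = T + S" "0 + T = T" "- T + T = 0" "S - T = S + - T"
    by (transfer, simp)+
  show "r *\<^sub>R (S + T) = r *\<^sub>R S + r *\<^sub>R T" "(r + s) *\<^sub>R T = r *\<^sub>R T + s *\<^sub>R T"
    "r *\<^sub>R s *\<^sub>R T = (r * s) *\<^sub>R T" "1 *\<^sub>R T = T"
    by (transfer, simp add: algebra_simps)+
  show "dist S T = norm (S - T)"
    by transfer (simp add: dist_norm)
  show "sgn T = inverse (norm T) *\<^sub>R T"
    by transfer (simp add: sgn_div_norm)
  show "(norm T = 0) = (T = 0)" "norm (S + T) \<le> norm S + norm T" "norm (r *\<^sub>R T) = \<bar>r\<bar> * norm T"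
    by (transfer, simp add: norm_triangle_ineq)+
  show "r *\<^sub>R T = complex_of_real r *\<^sub>C T"
    by (rule op_eqI) (simp add: op_apply_scaleC_left op_apply_scaleR_left scaleR_scaleC)
  show "c *\<^sub>C (S + T) = c *\<^sub>C S + c *\<^sub>C T" "(c + d) *\<^sub>C T = c *\<^sub>C T + d *\<^sub>C T"
    "c *\<^sub>C (d *\<^sub>C T) = (c * d) *\<^sub>C T"
    by (rule op_eqI, simp add: op_apply_scaleC_left op_apply_add_left scaleC_add_right
        scaleC_add_left scaleC_scaleC)+
  show "norm (c *\<^sub>C T) = cmod c * norm T"
  proof (rule antisym[OF norm_op_le])
    have "(inverse c * c) *\<^sub>C T = inverse c *\<^sub>C (c *\<^sub>C T)"
      by (rule op_eqI) (simp add: op_apply_scaleC_left scaleC_scaleC)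
    moreover have "1 *\<^sub>C T = T"
      by (rule op_eqI) (simp add: op_apply_scaleC_left)
    ultimately have le: "norm T \<le> inverse (cmod c) * norm (c *\<^sub>C T)" if "c \<noteq> 0"
      using norm_op_le[of "inverse c" "c *\<^sub>C T"] that by (simp add: norm_inverse)
    have "0 \<le> norm (c *\<^sub>C T)"
      by transfer simp
    moreover have "cmod c * norm T \<le> norm (c *\<^sub>C T)" if "c \<noteq> 0"
      using mult_left_mono[OF le[OF that] norm_ge_zero[of c]] that
      by (simp add: mult.assoc[symmetric])
    ultimately show "cmod c * norm T \<le> norm (c *\<^sub>C T)"
      by (cases "c = 0") simp_all
  qed
qed (rule uniformity_bounded_op_def open_bounded_op_def)+

end

instance bounded_op :: (complex_banach) complex_banach
proof
  fix X :: "nat \<Rightarrow> 'a bounded_op"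
  assume "Cauchy X"
  then have "Cauchy (\<lambda>n. blinfun_of_op (X n))"
    by (simp add: Cauchy_def dist_bounded_op.rep_eq)
  then obtain L where L: "(\<lambda>n. blinfun_of_op (X n)) \<longlonglongrightarrow> L"
    using Cauchy_convergent unfolding convergent_def by blast
  have lim: "(\<lambda>n. blinfun_apply (blinfun_of_op (X n)) x) \<longlonglongrightarrow> blinfun_apply L x" for x
    by (rule blinfun.tendsto[OF L tendsto_const])
  have "blinfun_apply L (c *\<^sub>C x) = c *\<^sub>C blinfun_apply L x" for c x
  proof (rule LIMSEQ_unique[OF lim])
    have "blinfun_apply (blinfun_of_op (X n)) (c *\<^sub>C x)
        = c *\<^sub>C blinfun_apply (blinfun_of_op (X n)) x" for n
      using blinfun_of_op[of "X n"] by simp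
    then show "(\<lambda>n. blinfun_apply (blinfun_of_op (X n)) (c *\<^sub>C x)) \<longlonglongrightarrow> c *\<^sub>C blinfun_apply L x"
      using bounded_linear.tendsto[OF bounded_linear_scaleC lim] by simp
  qed
  then have "blinfun_of_op (op_of_blinfun L) = L"
    by (simp add: op_of_blinfun_inverse)
  then have "X \<longlonglongrightarrow> op_of_blinfun L"
    using L by (simp add: tendsto_iff dist_bounded_op.rep_eq)
  then show "convergent X"
    by (auto simp: convergent_def)
qed

instantiation bounded_op :: (complex_banach) complex_banach_algebra
begin

lift_definition times_bounded_op :: "'a bounded_op \<Rightarrow> 'a bounded_op \<Rightarrow> 'a bounded_op"
  is blinfun_compose
  by simp

lift_definition one_bounded_op :: "'a bounded_op" is id_blinfun
  by simp

lemma op_apply_mult: "op_apply (S * T) x = op_apply S (op_apply T x)"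
  by transfer simp

lemma op_apply_one: "op_apply 1 x = x"
  by transfer simp

instance
proof
  fix S T U :: "'a bounded_op" and r :: real and c :: complex
  interpret S: bounded_linear "op_apply S" by (rule bounded_linear_op_apply)
  show "S * T * U = S * (T * U)" "(S + T) * U = S * U + T * U" "S * (T + U) = S * T + S * U"
    "1 * T = T" "T * 1 = T" "r *\<^sub>R S * T = r *\<^sub>R (S * T)" "S * r *\<^sub>R T = r *\<^sub>R (S * T)"
    "c *\<^sub>C S * T = c *\<^sub>C (S * T)" "S * c *\<^sub>C T = c *\<^sub>C (S * T)"
    by (rule op_eqI, simp add: op_apply_mult op_apply_one op_apply_add_left op_apply_scaleR_left
        op_apply_scaleC_left op_apply_scaleC S.add S.scaleR)+
  show "norm (S * T) \<le> norm S * norm T"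
    by transfer (rule norm_blinfun_compose)
qed

end

lift_definition left_mult :: "'a :: complex_banach_algebra \<Rightarrow> 'a bounded_op"
  is blinfun_mult_right
  by (simp add: mult_scaleC_right)

lift_definition right_mult :: "'a :: complex_banach_algebra \<Rightarrow> 'a bounded_op"
  is blinfun_mult_left
  by (simp add: mult_scaleC_left)

lemma op_apply_left_mult [simp]: "op_apply (left_mult T) S = T * S"
  by transfer simp

lemma op_apply_right_mult [simp]: "op_apply (right_mult T) S = S * T"
  by transfer simp

text \<open>
  The operator described here exists by the Riesz representation theorem, and is unique
  because the inner product is definite.
\<close>

definition adjoint_op :: "'h :: complex_hilbert_space bounded_op \<Rightarrow> 'h bounded_op" where
  "adjoint_op T = (THE S. \<forall>x y. cinner (op_apply T x) y = cinner x (op_apply S y))"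


section \<open>Descent, ascent and Drazin spectra\<close>

definition null_space :: "'a :: complex_banach bounded_op \<Rightarrow> 'a set" where
  "null_space U = {x. op_apply U x = 0}"

text \<open>\<^const>\<open>Inf\<close> of the empty set is \<open>\<infinity>\<close> in \<^typ>\<open>enat\<close>.\<close>

definition descent :: "'a :: complex_banach bounded_op \<Rightarrow> enat" where
  "descent U = Inf {enat n | n. range (op_apply (U ^ n)) = range (op_apply (U ^ (n + 1)))}"

definition ascent :: "'a :: complex_banach bounded_op \<Rightarrow> enat" where
  "ascent U = Inf {enat n | n. null_space (U ^ n) = null_space (U ^ (n + 1))}"

definition descent_spectrum :: "'a :: complex_banach bounded_op \<Rightarrow> complex set" where
  "descent_spectrum U = {l. descent (U - l *\<^sub>C 1) = \<infinity>}"

definition ascent_spectrum :: "'a :: complex_banach bounded_op \<Rightarrow> complex set" where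
  "ascent_spectrum U = {l. ascent (U - l *\<^sub>C 1) = \<infinity>}"

definition drazin_invertible :: "'a :: complex_banach_algebra \<Rightarrow> bool" where
  "drazin_invertible a \<longleftrightarrow> (\<exists>b. \<exists>m :: nat. a ^ m * b * a = a ^ m \<and> b * a * b = b \<and> a * b = b * a)"

definition drazin_spectrum :: "'a :: complex_banach_algebra \<Rightarrow> complex set" where
  "drazin_spectrum a = {l. \<not> drazin_invertible (a - l *\<^sub>C 1)}"

end

theory Submission
  imports Defs
begin

text \<open>
  The operators \<open>left_mult A\<close> and \<open>right_mult A\<close> are governed by the algebra of \<open>A\<close>: the range of
  \<open>left_mult (A ^ n)\<close> lies in that of \<open>left_mult (A ^ (n + 1))\<close> iff \<open>A ^ n\<close> is a right multiple
  \<open>A ^ (n + 1) * C\<close>, and for \<open>right_mult\<close> iff it is a left multiple \<open>C * A ^ (n + 1)\<close>. On a Hilbert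
  space, Douglas' lemma (\<open>Douglas_factorization\<close>) says that \<open>A ^ n = A ^ (n + 1) * C\<close> is solvable
  as soon as the range of \<open>A ^ n\<close> lies in that of \<open>A ^ (n + 1)\<close>; hence \<open>left_mult A\<close> and \<open>A\<close>
  have the same descent. They have the same ascent because a vector in a null space can be
  replaced by a rank one operator onto its span. Taking adjoints turns right multiples into left
  multiples, so \<open>right_mult A\<close> has the descent and the ascent of \<open>adjoint_op A\<close>. Everything applies
  to \<open>T - l *\<^sub>C 1\<close>, whose adjoint is \<open>adjoint_op T - cnj l *\<^sub>C 1\<close>; this is where the complex
  conjugates come from.

  Let \<open>T\<close> be self-adjoint. If \<open>l\<close> is not real, then \<open>T - l *\<^sub>C 1\<close> is bounded below and
  surjective, so \<open>l\<close> is in none of the spectra. If \<open>l\<close> is real, then \<open>A = T - l *\<^sub>C 1\<close> is self-adjoint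
  and \<open>A * A\<close> has the null space of \<open>A\<close>. So the ascent is at most \<open>1\<close>, and all the ascent spectra
  are empty. If moreover \<open>A\<close> has finite descent, then \<open>A ^ n = A ^ (n + 1) * C\<close> for some \<open>n\<close>;
  cancelling powers of \<open>A\<close> gives \<open>A = A * A * C\<close>, the adjoint of this equation is
  \<open>A = adjoint_op C * A * A\<close>, and the two together make \<open>A\<close> Drazin invertible.
\<close>

section \<open>Complex inner products\<close>

lemma cinner_add_right: "cinner x (y + z) = cinner x y + cinner x (z :: 'h :: complex_hilbert_space)"
  by (metis cinner_add_left cinner_commute complex_cnj_add)

lemma cinner_scaleC_right: "cinner x (c *\<^sub>C y) = cnj c * cinner x (y :: 'h :: complex_hilbert_space)"
  by (metis cinner_commute cinner_scaleC_left complex_cnj_mult)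

lemma cinner_zero_left [simp]: "cinner 0 (x :: 'h :: complex_hilbert_space) = 0"
  using cinner_add_left[of 0 0 x] by simp

lemma cinner_zero_right [simp]: "cinner (x :: 'h :: complex_hilbert_space) 0 = 0"
  using cinner_add_right[of x 0 0] by simp

lemma cinner_diff_left: "cinner (x - y) z = cinner x z - cinner y (z :: 'h :: complex_hilbert_space)"
  using cinner_add_left[of "x - y" y z] by simp

lemma cinner_diff_right: "cinner x (y - z) = cinner x y - cinner x (z :: 'h :: complex_hilbert_space)"
  using cinner_add_right[of x "y - z" z] by simp

lemma norm_square_eq_cinner: "(norm (x :: 'h :: complex_hilbert_space))\<^sup>2 = Re (cinner x x)"
  by (simp add: cinner_norm)

lemma cinner_self_eq_0_iff [simp]: "cinner x x = 0 \<longleftrightarrow> x = (0 :: 'h :: complex_hilbert_space)"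
  by (simp add: cinner_norm)

lemma cinner_ext:
  fixes a b :: "'h :: complex_hilbert_space"
  assumes "\<And>x. cinner x a = cinner x b"
  shows "a = b"
proof -
  have "cinner (a - b) (a - b) = 0"
    using assms by (simp add: cinner_diff_right)
  then show ?thesis by simp
qed

lemma Re_cinner_commute: "Re (cinner y x) = Re (cinner x (y :: 'h :: complex_hilbert_space))"
  by (subst cinner_commute) simp

lemma parallelogram_law:
  "(norm (x - y))\<^sup>2 = 2 * (norm x)\<^sup>2 + 2 * (norm y)\<^sup>2 - (norm (x + y))\<^sup>2"
  for x y :: "'h :: complex_hilbert_space"
  by (simp add: norm_square_eq_cinner cinner_add_left cinner_add_right cinner_diff_left
      cinner_diff_right)

lemma norm_add_square_orthogonal:
  "cinner x y = 0 \<Longrightarrow> (norm (x + y))\<^sup>2 = (norm x)\<^sup>2 + (norm y)\<^sup>2"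
  for x y :: "'h :: complex_hilbert_space"
  by (simp add: norm_square_eq_cinner cinner_add_left cinner_add_right Re_cinner_commute[of y x])

text \<open>
  Removing from \<open>x\<close> its component along \<open>y\<close> is the source both of the Cauchy-Schwarz inequality
  (the left-hand side is nonnegative) and of the orthogonality of \<open>v - m\<close> to a closed subspace
  in which \<open>m\<close> is a point nearest to \<open>v\<close> (for \<open>x = v - m\<close> and \<open>y\<close> in the subspace, the left-hand
  side cannot be smaller than \<open>(norm x)\<^sup>2\<close>).
\<close>

lemma norm_diff_component_square:
  fixes x y :: "'h :: complex_hilbert_space"
  assumes "y \<noteq> 0"
  shows "(norm (x - (cinner x y / complex_of_real ((norm y)\<^sup>2)) *\<^sub>C y))\<^sup>2
    = (norm x)\<^sup>2 - (cmod (cinner x y))\<^sup>2 / (norm y)\<^sup>2"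
proof -
  define c where "c = cinner x y / complex_of_real ((norm y)\<^sup>2)"
  have c: "cinner x y = c * complex_of_real ((norm y)\<^sup>2)"
    using assms by (simp add: c_def)
  have "cinner (x - c *\<^sub>C y) (c *\<^sub>C y) = 0"
    by (simp add: cinner_diff_left cinner_scaleC_left cinner_scaleC_right c cinner_norm)
  then have "(norm x)\<^sup>2 = (norm (x - c *\<^sub>C y))\<^sup>2 + (norm (c *\<^sub>C y))\<^sup>2"
    using norm_add_square_orthogonal[of "x - c *\<^sub>C y" "c *\<^sub>C y"] by simp
  moreover have "(norm (c *\<^sub>C y))\<^sup>2 = (cmod (cinner x y))\<^sup>2 / (norm y)\<^sup>2"
    using assms by (simp add: norm_scaleC c_def norm_divide norm_mult power2_eq_square)
  ultimately show ?thesis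
    by (simp add: c_def)
qed

lemma Cauchy_Schwarz_cinner:
  fixes x y :: "'h :: complex_hilbert_space"
  shows "cmod (cinner x y) \<le> norm x * norm y"
proof (cases "y = 0")
  case False
  have "(cmod (cinner x y))\<^sup>2 / (norm y)\<^sup>2 \<le> (norm x)\<^sup>2"
    using norm_diff_component_square[OF False, of x] zero_le_power2 by (smt (verit))
  then have "(cmod (cinner x y))\<^sup>2 \<le> (norm x * norm y)\<^sup>2"
    using False by (simp add: divide_simps power_mult_distrib)
  then show ?thesis
    by (rule power2_le_imp_le) simp
qed simp

section \<open>Orthogonal projection, the Riesz representation and the adjoint\<close>

text \<open>
  The projection is a nearest point: by the parallelogram law a sequence in \<open>M\<close> that minimizes the
  distance to \<open>x\<close> is a Cauchy sequence.
\<close>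

lemma orthogonal_projection_exists:
  fixes M :: "'h :: complex_hilbert_space set"
  assumes "closed M" "M \<noteq> {}"
    and add: "\<And>x y. x \<in> M \<Longrightarrow> y \<in> M \<Longrightarrow> x + y \<in> M"
    and scale: "\<And>c x. x \<in> M \<Longrightarrow> c *\<^sub>C x \<in> M"
  shows "\<exists>m\<in>M. \<forall>z\<in>M. cinner (x - m) z = 0"
proof -
  define D where "D = (INF m\<in>M. (norm (x - m))\<^sup>2)"
  have bdd: "bdd_below ((\<lambda>m. (norm (x - m))\<^sup>2) ` M)"
    by (rule bdd_belowI[of _ 0]) auto
  have D_le: "D \<le> (norm (x - m))\<^sup>2" if "m \<in> M" for m
    unfolding D_def by (rule cINF_lower[OF bdd that])
  have "\<exists>m\<in>M. (norm (x - m))\<^sup>2 < D + 1 / Suc k" for k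
    using cINF_less_iff[OF \<open>M \<noteq> {}\<close> bdd, of "D + 1 / Suc k"] by (simp add: D_def)
  then obtain m where m: "\<And>k. m k \<in> M" "\<And>k. (norm (x - m k))\<^sup>2 < D + 1 / Suc k"
    by metis
  \<comment> \<open>The midpoint of \<open>m k\<close> and \<open>m l\<close> is in \<open>M\<close>, so its squared distance to \<open>x\<close> is at least \<open>D\<close>;
    the parallelogram law then leaves no room between \<open>m k\<close> and \<open>m l\<close>.\<close>
  have close: "(norm (m k - m l))\<^sup>2 \<le> 2 / Suc k + 2 / Suc l" for k l
  proof -
    have "(1 / 2) *\<^sub>R (m k + m l) \<in> M"
      by (simp add: scaleR_scaleC m add scale)
    from D_le[OF this]
    have "4 * D \<le> (2 * norm (x - (1 / 2) *\<^sub>R (m k + m l)))\<^sup>2"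
      by (simp add: power_mult_distrib)
    also have "2 * norm (x - (1 / 2) *\<^sub>R (m k + m l)) = norm (2 *\<^sub>R (x - (1 / 2) *\<^sub>R (m k + m l)))"
      by simp
    also have "2 *\<^sub>R (x - (1 / 2) *\<^sub>R (m k + m l)) = (x - m k) + (x - m l)"
      by (simp add: algebra_simps scaleR_2)
    finally have "4 * D \<le> (norm ((x - m k) + (x - m l)))\<^sup>2" .
    moreover have "(norm (m k - m l))\<^sup>2 = (norm ((x - m k) - (x - m l)))\<^sup>2"
      by (simp add: norm_minus_commute)
    ultimately show ?thesis
      using m(2)[of k] m(2)[of l] parallelogram_law[of "x - m k" "x - m l"] by simp
  qed
  have "Cauchy m"
  proof (rule metric_CauchyI)
    fix e :: real assume "e > 0"
    then obtain N where N: "4 / Suc N < e\<^sup>2"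
      using reals_Archimedean[of "e\<^sup>2 / 4"] by (auto simp: field_simps)
    have "dist (m k) (m l) < e" if "k \<ge> N" "l \<ge> N" for k l
    proof -
      have "2 / Suc k \<le> 2 / Suc N" "2 / Suc l \<le> 2 / Suc N"
        using that by (auto simp: field_simps)
      then have "(norm (m k - m l))\<^sup>2 < e\<^sup>2"
        using close[of k l] N by linarith
      then show ?thesis
        using \<open>e > 0\<close> by (simp add: dist_norm power2_less_imp_less)
    qed
    then show "\<exists>N. \<forall>k\<ge>N. \<forall>l\<ge>N. dist (m k) (m l) < e" by blast
  qed
  then obtain p where p: "m \<longlonglongrightarrow> p"
    using Cauchy_convergent convergent_def by blast
  have "p \<in> M"
    using closed_sequentially[OF \<open>closed M\<close> m(1) p] .
  have min: "(norm (x - p))\<^sup>2 \<le> D"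
  proof (rule LIMSEQ_le)
    show "(\<lambda>k. (norm (x - m k))\<^sup>2) \<longlonglongrightarrow> (norm (x - p))\<^sup>2"
      by (intro tendsto_intros p)
    show "(\<lambda>k. D + 1 / Suc k) \<longlonglongrightarrow> D"
      using tendsto_add[OF tendsto_const[of D] LIMSEQ_inverse_real_of_nat]
      by (simp add: inverse_eq_divide)
    show "\<exists>N. \<forall>k\<ge>N. (norm (x - m k))\<^sup>2 \<le> D + 1 / Suc k"
      using m(2) less_imp_le by blast
  qed
  \<comment> \<open>If \<open>x - p\<close> had a component along \<open>z\<close>, then moving \<open>p\<close> by it would reduce the distance.\<close>
  have "cinner (x - p) z = 0" if "z \<in> M" for z
  proof (cases "z = 0")
    case False
    define c where "c = cinner (x - p) z / complex_of_real ((norm z)\<^sup>2)"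
    have "D \<le> (norm (x - (p + c *\<^sub>C z)))\<^sup>2"
      by (intro D_le add scale that \<open>p \<in> M\<close>)
    also have "x - (p + c *\<^sub>C z) = x - p - c *\<^sub>C z"
      by simp
    finally have "(cmod (cinner (x - p) z))\<^sup>2 / (norm z)\<^sup>2 \<le> 0"
      using min norm_diff_component_square[OF False, of "x - p"] by (simp add: c_def)
    then show ?thesis
      using False by (simp add: divide_le_0_iff)
  qed simp
  with \<open>p \<in> M\<close> show ?thesis by blast
qed

text \<open>
  A nonzero functional is determined up to a factor by its null space, and the representing
  vector is a multiple of any vector \<open>u \<noteq> 0\<close> orthogonal to that null space.
\<close>

lemma Riesz_representation:
  fixes f :: "'h :: complex_hilbert_space \<Rightarrow> complex"
  assumes f: "bounded_linear f" and f_scale: "\<And>c x. f (c *\<^sub>C x) = c * f x"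
  shows "\<exists>z. \<forall>x. f x = cinner x z"
proof (cases "\<forall>x. f x = 0")
  case True
  then show ?thesis by (intro exI[of _ 0]) simp
next
  case False
  then obtain v where v: "f v \<noteq> 0" by blast
  interpret f: bounded_linear f by (rule f)
  have "closed {x. f x = 0}"
    by (intro closed_Collect_eq linear_continuous_on f continuous_on_const)
  then have "\<exists>m\<in>{x. f x = 0}. \<forall>z\<in>{x. f x = 0}. cinner (v - m) z = 0"
    by (rule orthogonal_projection_exists) (auto simp: f.add f_scale intro: exI[of _ 0] f.zero)
  then obtain m where m: "f m = 0" "\<And>z. f z = 0 \<Longrightarrow> cinner (v - m) z = 0"
    by blast
  define u where "u = v - m"
  have fu: "f u \<noteq> 0"
    using v m by (simp add: u_def f.diff)
  then have "u \<noteq> 0" by (auto simp: f.zero)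
  have "f x = cinner x ((cnj (f u) / cinner u u) *\<^sub>C u)" for x
  proof -
    \<comment> \<open>This combination of \<open>x\<close> and \<open>u\<close> is in the null space, hence orthogonal to \<open>u\<close>.\<close>
    have "f (f u *\<^sub>C x - f x *\<^sub>C u) = 0"
      by (simp add: f.diff f_scale)
    then have "cinner u (f u *\<^sub>C x - f x *\<^sub>C u) = 0"
      using m(2) u_def by blast
    then have "cinner (f u *\<^sub>C x - f x *\<^sub>C u) u = 0"
      by (subst cinner_commute) simp
    then have "f u * cinner x u = f x * cinner u u"
      by (simp add: cinner_diff_left cinner_scaleC_left)
    moreover have "cnj (cinner u u) = cinner u u"
      using cinner_commute[of u u] by simp
    ultimately show ?thesis
      using \<open>u \<noteq> 0\<close> by (simp add: cinner_scaleC_right field_simps)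
  qed
  then show ?thesis by blast
qed

lemma bounded_op_exists:
  fixes f :: "'a :: complex_normed_vector \<Rightarrow> 'a"
  assumes "\<And>x y. f (x + y) = f x + f y" "\<And>c x. f (c *\<^sub>C x) = c *\<^sub>C f x"
    "\<And>x. norm (f x) \<le> norm x * K"
  shows "\<exists>S. op_apply S = f"
proof -
  have "bounded_linear f"
    by (rule bounded_linear_intro[where K = K]) (simp_all add: assms scaleR_scaleC)
  then have "blinfun_apply (Blinfun f) = f"
    by (rule bounded_linear_Blinfun_apply)
  then have "op_apply (op_of_blinfun (Blinfun f)) = f"
    using assms(2) by (simp add: op_apply.rep_eq op_of_blinfun_inverse)
  then show ?thesis by blast
qed

text \<open>
  The Riesz representation of \<open>x \<mapsto> cinner (op_apply T x) y\<close> is the value at \<open>y\<close> of the operator that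
  the definition of \<^const>\<open>adjoint_op\<close> describes.
\<close>

lemma cinner_adjoint_op:
  fixes T :: "'h :: complex_hilbert_space bounded_op"
  shows "cinner (op_apply T x) y = cinner x (op_apply (adjoint_op T) y)"
proof -
  interpret T: bounded_linear "op_apply T" by (rule bounded_linear_op_apply)
  have "bounded_linear (\<lambda>x. cinner (op_apply T x) y)" for y
  proof (rule bounded_linear_intro[where K = "onorm (op_apply T) * norm y"])
    fix x
    have "cmod (cinner (op_apply T x) y) \<le> norm (op_apply T x) * norm y"
      by (rule Cauchy_Schwarz_cinner)
    also have "\<dots> \<le> (onorm (op_apply T) * norm x) * norm y"
      by (intro mult_right_mono onorm bounded_linear_op_apply norm_ge_zero)
    finally show "cmod (cinner (op_apply T x) y) \<le> norm x * (onorm (op_apply T) * norm y)"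
      by (simp add: mult_ac)
  qed (simp_all add: T.add cinner_add_left scaleR_scaleC op_apply_scaleC cinner_scaleC_left
        scaleR_conv_of_real)
  then have "\<exists>z. \<forall>x. cinner (op_apply T x) y = cinner x z" for y
    by (rule Riesz_representation) (simp add: op_apply_scaleC cinner_scaleC_left)
  then obtain g where g: "\<And>x y. cinner (op_apply T x) y = cinner x (g y)"
    by metis
  have "\<exists>S. op_apply S = g"
  proof (rule bounded_op_exists)
    show "g (x + y) = g x + g y" for x y
      by (rule cinner_ext) (simp add: g[symmetric] cinner_add_right)
    show "g (c *\<^sub>C x) = c *\<^sub>C g x" for c x
      by (rule cinner_ext) (simp add: g[symmetric] cinner_scaleC_right)
    show "norm (g y) \<le> norm y * onorm (op_apply T)" for y
    proof (cases "g y = 0")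
      case False
      have "norm (g y) * norm (g y) = cmod (cinner (g y) (g y))"
        by (simp add: cinner_norm power2_eq_square norm_mult)
      also have "\<dots> = cmod (cinner (op_apply T (g y)) y)"
        by (simp add: g)
      also have "\<dots> \<le> norm (op_apply T (g y)) * norm y"
        by (rule Cauchy_Schwarz_cinner)
      also have "\<dots> \<le> (onorm (op_apply T) * norm (g y)) * norm y"
        by (intro mult_right_mono onorm bounded_linear_op_apply norm_ge_zero)
      finally show ?thesis
        using False by (simp add: mult_ac)
    qed (simp add: onorm_pos_le[OF bounded_linear_op_apply])
  qed
  then obtain S where S: "op_apply S = g" by blast
  have "\<forall>x y. cinner (op_apply T x) y = cinner x (op_apply (adjoint_op T) y)"
    unfolding adjoint_op_def
  proof (rule theI[of _ S])
    show "\<forall>x y. cinner (op_apply T x) y = cinner x (op_apply S y)"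
      by (simp add: S g)
    show "S' = S" if "\<forall>x y. cinner (op_apply T x) y = cinner x (op_apply S' y)" for S'
      using that by (intro op_eqI cinner_ext) (simp add: S g[symmetric])
  qed
  then show ?thesis by blast
qed

lemma adjoint_op_eqI:
  fixes S T :: "'h :: complex_hilbert_space bounded_op"
  assumes "\<And>x y. cinner (op_apply T x) y = cinner x (op_apply S y)"
  shows "adjoint_op T = S"
  by (intro op_eqI cinner_ext) (simp add: assms flip: cinner_adjoint_op)

lemma adjoint_op_adjoint_op [simp]: "adjoint_op (adjoint_op T) = T"
  by (rule adjoint_op_eqI) (metis cinner_adjoint_op cinner_commute)

lemma adjoint_op_mult: "adjoint_op (S * T) = adjoint_op T * adjoint_op S"
  by (rule adjoint_op_eqI) (simp add: op_apply_mult cinner_adjoint_op)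

lemma adjoint_op_one [simp]: "adjoint_op 1 = 1"
  by (rule adjoint_op_eqI) (simp add: op_apply_one)

lemma adjoint_op_zero [simp]: "adjoint_op 0 = 0"
  by (rule adjoint_op_eqI) (simp add: op_apply.rep_eq zero_bounded_op.rep_eq)

lemma adjoint_op_power: "adjoint_op (T ^ n) = adjoint_op T ^ n"
  by (induction n) (simp_all add: adjoint_op_mult power_commutes)

lemma op_apply_diff_left: "op_apply (S - T) x = op_apply S x - op_apply T x"
  by transfer (simp add: blinfun.diff_left)

lemma adjoint_op_diff_scalar: "adjoint_op (T - l *\<^sub>C 1) = adjoint_op T - cnj l *\<^sub>C 1"
  by (rule adjoint_op_eqI) (simp add: op_apply_diff_left op_apply_scaleC_left op_apply_one
      cinner_diff_left cinner_diff_right cinner_scaleC_left cinner_scaleC_right cinner_adjoint_op)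

section \<open>Factorization of operators with nested ranges\<close>

text \<open>
  A form of the open mapping theorem. By Baire's theorem, the points \<open>x\<close> for which \<open>A x\<close> has a
  preimage under \<open>B\<close> of norm at most \<open>n\<close> are, for some \<open>n\<close>, dense in a ball; so for every \<open>x\<close> the
  equation \<open>B y = A x\<close> can be solved, with control of the norm of \<open>y\<close>, up to an error \<open>A x'\<close>
  where \<open>x'\<close> is half as long as \<open>x\<close>. Iterating this and adding up the solutions gives an
  exact one.
\<close>

lemma bounded_preimages:
  fixes A :: "'a :: banach \<Rightarrow> 'c :: real_normed_vector" and B :: "'b :: banach \<Rightarrow> 'c"
  assumes A: "bounded_linear A" and B: "bounded_linear B" and sub: "range A \<subseteq> range B"
  shows "\<exists>K. \<forall>x. \<exists>y. B y = A x \<and> norm y \<le> K * norm x"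
proof -
  interpret A: bounded_linear A by (rule A)
  interpret B: bounded_linear B by (rule B)
  define X where "X = (\<lambda>n :: nat. {x. \<exists>y. B y = A x \<and> norm y \<le> real n})"
  have "(\<Union>n. closure (X n)) = UNIV"
  proof -
    have "\<exists>n. x \<in> X n" for x
    proof -
      obtain y where "B y = A x" using sub by (metis imageE rangeI subsetD)
      moreover obtain n :: nat where "norm y \<le> real n" using real_arch_simple by blast
      ultimately show ?thesis by (auto simp: X_def)
    qed
    then have "x \<in> (\<Union>n. closure (X n))" for x
      using closure_subset[THEN subsetD] by (meson UN_I UNIV_I)
    then show ?thesis by auto
  qed
  moreover have "interior (\<Union>n. closure (X n)) = {}" if "\<And>n. interior (closure (X n)) = {}"
  proof -
    have "euclidean interior_of (\<Union>n. closure (X n)) = {}"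
    proof (rule Baire_category_alt)
      show "completely_metrizable_space (euclidean :: 'a topology) \<or>
          locally_compact_space (euclidean :: 'a topology) \<and> regular_space (euclidean :: 'a topology)"
        using completely_metrizable_space_euclidean by blast
      show "closedin euclidean S \<and> euclidean interior_of S = {}"
        if "S \<in> range (\<lambda>n. closure (X n))" for S
        using that \<open>\<And>n. interior (closure (X n)) = {}\<close> closed_closedin[of S] by auto
    qed simp
    then show ?thesis by simp
  qed
  ultimately obtain n where "interior (closure (X n)) \<noteq> {}"
    using interior_UNIV by force
  then obtain x0 r where r: "r > 0" and ball: "ball x0 r \<subseteq> closure (X n)"
    by (metis all_not_in_conv mem_interior)
  \<comment> \<open>Differences of points of \<open>X n\<close> move the ball to the origin, at the cost of doubling \<open>n\<close>.\<close>
  have approx: "\<exists>u y. B y = A u \<and> norm y \<le> 2 * real n \<and> norm (w - u) < e"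
    if w: "norm w < r" and e: "e > 0" for w e
  proof -
    have "x0 + w \<in> closure (X n)" "x0 \<in> closure (X n)"
      using ball r w by (auto simp: subset_eq dist_norm)
    then obtain a b where ab: "a \<in> X n" "dist a (x0 + w) < e / 2" "b \<in> X n" "dist b x0 < e / 2"
      using e by (meson closure_approachable half_gt_zero)
    then obtain y z where yz: "B y = A a" "norm y \<le> real n" "B z = A b" "norm z \<le> real n"
      by (auto simp: X_def)
    have "w - (a - b) = (x0 + w - a) - (x0 - b)" by simp
    then have "norm (w - (a - b)) \<le> norm (x0 + w - a) + norm (x0 - b)"
      by (metis norm_triangle_ineq4)
    then have "norm (w - (a - b)) < e"
      using ab by (simp add: dist_norm norm_minus_commute)
    moreover have "norm (y - z) \<le> 2 * real n"
      using norm_triangle_ineq4[of y z] yz by linarith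
    ultimately show ?thesis
      using yz by (intro exI[of _ "a - b"] exI[of _ "y - z"]) (simp add: A.diff B.diff)
  qed
  \<comment> \<open>For \<open>x \<noteq> 0\<close>, \<open>approx\<close> is applied to the multiple of \<open>x\<close> of norm \<open>r / 2\<close> with error \<open>r / 4\<close>;
    scaling back by \<open>t = 2 * norm x / r\<close> makes the error \<open>norm x / 2\<close> and the bound
    \<open>2 * n * t = M * norm x\<close>.\<close>
  define M where "M = 4 * real n / r"
  have "\<exists>x' y. B y = A x - A x' \<and> norm y \<le> M * norm x \<and> norm x' \<le> norm x / 2" for x
  proof (cases "x = 0")
    case True
    then show ?thesis by (intro exI[of _ 0]) (simp add: A.zero B.zero)
  next
    case False
    define t where "t = 2 * norm x / r"
    have t: "t > 0" using False r by (simp add: t_def)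
    have "norm ((1 / t) *\<^sub>R x) < r"
      using False r by (simp add: t_def)
    from approx[OF this, of "r / 4"] obtain u y where
      uy: "B y = A u" "norm y \<le> 2 * real n" "norm ((1 / t) *\<^sub>R x - u) < r / 4"
      using r by auto
    have "x - t *\<^sub>R u = t *\<^sub>R ((1 / t) *\<^sub>R x - u)"
      using t by (simp add: algebra_simps)
    then have "norm (x - t *\<^sub>R u) = t * norm ((1 / t) *\<^sub>R x - u)"
      using t by simp
    also have "\<dots> \<le> t * (r / 4)"
      using t uy by (intro mult_left_mono) auto
    also have "\<dots> = norm x / 2"
      using r by (simp add: t_def)
    finally have "norm (x - t *\<^sub>R u) \<le> norm x / 2" .
    moreover have "norm (t *\<^sub>R y) \<le> M * norm x"
    proof -
      have "norm (t *\<^sub>R y) \<le> t * (2 * real n)"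
        using t uy by (simp add: mult_left_mono)
      also have "\<dots> = M * norm x" by (simp add: t_def M_def)
      finally show ?thesis .
    qed
    ultimately show ?thesis
      using uy by (intro exI[of _ "x - t *\<^sub>R u"] exI[of _ "t *\<^sub>R y"])
        (simp add: A.diff A.scaleR B.scaleR)
  qed
  then obtain g h where gh: "\<And>x. B (h x) = A x - A (g x)" "\<And>x. norm (h x) \<le> M * norm x"
    "\<And>x. norm (g x) \<le> norm x / 2"
    by metis
  have "\<exists>y. B y = A x \<and> norm y \<le> (2 * M) * norm x" for x
  proof -
    \<comment> \<open>\<open>z k\<close> is what remains to be solved after \<open>k\<close> steps, and \<open>h (z k)\<close> the next correction.\<close>
    define z where "z = (\<lambda>k. (g ^^ k) x)"
    have z: "norm (z k) \<le> norm x * (1 / 2) ^ k" for k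
    proof (induction k)
      case (Suc k)
      have "norm (z (Suc k)) \<le> norm (z k) / 2"
        using gh(3) by (simp add: z_def)
      with Suc show ?case by simp
    qed (simp add: z_def)
    have M: "M \<ge> 0" using r by (simp add: M_def)
    have hz: "norm (h (z k)) \<le> M * norm x * (1 / 2) ^ k" for k
      using gh(2)[of "z k"] mult_left_mono[OF z[of k] M] by simp
    have geo: "(\<lambda>k. M * norm x * (1 / 2) ^ k) sums (M * norm x * 2)"
      using sums_mult[OF geometric_sums[of "1 / 2 :: real"], of "M * norm x"] by simp
    have sm: "summable (\<lambda>k. h (z k))"
      by (rule summable_comparison_test'[OF sums_summable[OF geo] hz])
    have "norm (\<Sum>k. h (z k)) \<le> (\<Sum>k. M * norm x * (1 / 2) ^ k)"
      by (rule norm_suminf_le[OF hz sums_summable[OF geo]])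
    then have "norm (\<Sum>k. h (z k)) \<le> (2 * M) * norm x"
      using sums_unique[OF geo] by (simp add: mult_ac)
    moreover have "B (\<Sum>k. h (z k)) = A x"
    proof -
      have "z \<longlonglongrightarrow> 0"
      proof (rule Lim_null_comparison)
        show "\<forall>\<^sub>F k in sequentially. norm (z k) \<le> norm x * (1 / 2) ^ k"
          using z by simp
        show "(\<lambda>k. norm x * (1 / 2) ^ k) \<longlonglongrightarrow> 0"
          by (intro tendsto_mult_right_zero LIMSEQ_power_zero) simp
      qed
      then have "(\<lambda>k. A (z k)) \<longlonglongrightarrow> 0"
        using A.tendsto A.zero by metis
      then have "(\<lambda>k. A (z k) - A (z (Suc k))) sums (A (z 0) - 0)"
        by (rule telescope_sums')
      moreover have "A (z k) - A (z (Suc k)) = B (h (z k))" for k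
        by (simp add: gh z_def)
      ultimately have "(\<lambda>k. B (h (z k))) sums A x"
        by (simp add: z_def)
      then show ?thesis
        using B.suminf[OF sm] sums_unique by metis
    qed
    ultimately show ?thesis by blast
  qed
  then show ?thesis by blast
qed

lemma op_apply_zero_left [simp]: "op_apply 0 x = 0"
  by transfer simp

lemma op_apply_zero_right [simp]: "op_apply T 0 = 0"
  using linear_0[OF bounded_linear.linear[OF bounded_linear_op_apply]] .

text \<open>
  Douglas' lemma. The equation \<open>B y = A x\<close> has exactly one solution \<open>y\<close> orthogonal to the null
  space of \<open>B\<close>. By uniqueness it depends linearly on \<open>x\<close>; the dependence is bounded because
  the solution of controlled norm from \<open>bounded_preimages\<close> only gets shorter when it is projected
  onto the orthogonal complement of that null space.
\<close>

lemma Douglas_factorization: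
  fixes A B :: "'h :: complex_hilbert_space bounded_op"
  assumes sub: "range (op_apply A) \<subseteq> range (op_apply B)"
  shows "\<exists>C. A = B * C"
proof -
  interpret A: bounded_linear "op_apply A" by (rule bounded_linear_op_apply)
  interpret B: bounded_linear "op_apply B" by (rule bounded_linear_op_apply)
  define N where "N = {z. op_apply B z = 0}"
  have N: "closed N" "N \<noteq> {}" "\<And>x y. x \<in> N \<Longrightarrow> y \<in> N \<Longrightarrow> x + y \<in> N"
    "\<And>c x. x \<in> N \<Longrightarrow> c *\<^sub>C x \<in> N" "\<And>x y. x \<in> N \<Longrightarrow> y \<in> N \<Longrightarrow> x - y \<in> N"
    unfolding N_def
    by (auto intro!: closed_Collect_eq linear_continuous_on bounded_linear_op_apply
        continuous_on_const exI[of _ 0] simp: B.zero B.add B.diff op_apply_scaleC)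
  obtain K where K: "\<And>x. \<exists>y. op_apply B y = op_apply A x \<and> norm y \<le> K * norm x"
    using bounded_preimages[OF bounded_linear_op_apply bounded_linear_op_apply sub] by blast
  have "\<exists>y. op_apply B y = op_apply A x \<and> norm y \<le> K * norm x \<and> (\<forall>z\<in>N. cinner y z = 0)" for x
  proof -
    obtain y where y: "op_apply B y = op_apply A x" "norm y \<le> K * norm x" using K by blast
    obtain p where p: "p \<in> N" "\<And>z. z \<in> N \<Longrightarrow> cinner (y - p) z = 0"
      using orthogonal_projection_exists[OF N(1-4)] by metis
    have "(norm y)\<^sup>2 = (norm (y - p))\<^sup>2 + (norm p)\<^sup>2"
      using norm_add_square_orthogonal[OF p(2)[OF p(1)]] by simp
    then have "norm (y - p) \<le> norm y"
      using power2_le_imp_le[of "norm (y - p)" "norm y"] zero_le_power2[of "norm p"] norm_ge_zero[of y]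
      by linarith
    then have "norm (y - p) \<le> K * norm x"
      using y(2) by linarith
    moreover have "op_apply B (y - p) = op_apply A x"
      using y(1) p(1) by (simp add: B.diff N_def)
    ultimately show ?thesis
      using p(2) by blast
  qed
  then obtain f where f: "\<And>x. op_apply B (f x) = op_apply A x" "\<And>x. norm (f x) \<le> K * norm x"
    "\<And>x z. z \<in> N \<Longrightarrow> cinner (f x) z = 0"
    by metis
  have unique: "y = f x"
    if "op_apply B y = op_apply A x" "\<And>z. z \<in> N \<Longrightarrow> cinner y z = 0" for x y
  proof -
    have "y - f x \<in> N"
      using that f by (simp add: N_def B.diff)
    then have "cinner (y - f x) (y - f x) = 0"
      using that f by (simp add: cinner_diff_left)
    then show ?thesis by simp
  qed
  have "\<exists>C. op_apply C = f"
  proof (rule bounded_op_exists)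
    show "f (x + y) = f x + f y" for x y
      by (rule unique[symmetric]) (simp_all add: f A.add B.add cinner_add_left)
    show "f (c *\<^sub>C x) = c *\<^sub>C f x" for c x
      by (rule unique[symmetric]) (simp_all add: f op_apply_scaleC cinner_scaleC_left)
    show "norm (f x) \<le> norm x * K" for x
      using f(2) by (simp add: mult.commute)
  qed
  then obtain C where "op_apply C = f" by blast
  then have "A = B * C"
    by (intro op_eqI) (simp add: op_apply_mult f)
  then show ?thesis by blast
qed

lemma range_subset_iff_factorization:
  fixes A B :: "'h :: complex_hilbert_space bounded_op"
  shows "range (op_apply A) \<subseteq> range (op_apply B) \<longleftrightarrow> (\<exists>C. A = B * C)"
  using Douglas_factorization[of A B] by (auto simp: op_apply_mult)

section \<open>Descent and ascent of multiplication operators\<close>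

lemma left_mult_power: "left_mult a ^ n = left_mult (a ^ n)"
  by (rule op_eqI, induction n) (simp_all add: op_apply_mult op_apply_one mult.assoc)

lemma right_mult_power: "right_mult a ^ n = right_mult (a ^ n)"
  by (rule op_eqI, induction n) (simp_all add: op_apply_mult op_apply_one mult.assoc power_commutes)

lemma left_mult_diff_scalar: "left_mult a - l *\<^sub>C 1 = left_mult (a - l *\<^sub>C 1)"
  by (rule op_eqI) (simp add: op_apply_diff_left op_apply_scaleC_left op_apply_one
      left_diff_distrib mult_scaleC_left)

lemma right_mult_diff_scalar: "right_mult a - l *\<^sub>C 1 = right_mult (a - l *\<^sub>C 1)"
  by (rule op_eqI) (simp add: op_apply_diff_left op_apply_scaleC_left op_apply_one
      right_diff_distrib mult_scaleC_right)

lemma range_power_Suc_subset: "range (op_apply (U ^ (n + 1))) \<subseteq> range (op_apply (U ^ n))"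
  by (metis Suc_eq_plus1 image_subset_iff op_apply_mult power_Suc2 rangeI)

lemma null_space_power_subset: "null_space (U ^ n) \<subseteq> null_space (U ^ (n + 1))"
  by (auto simp: null_space_def op_apply_mult)

lemma descent_eq:
  "descent U = Inf {enat n | n. range (op_apply (U ^ n)) \<subseteq> range (op_apply (U ^ (n + 1)))}"
proof -
  have "range (op_apply (U ^ n)) = range (op_apply (U ^ (n + 1))) \<longleftrightarrow>
      range (op_apply (U ^ n)) \<subseteq> range (op_apply (U ^ (n + 1)))" for n
    using range_power_Suc_subset[of U n] by blast
  then show ?thesis by (simp only: descent_def)
qed

lemma ascent_eq: "ascent U = Inf {enat n | n. null_space (U ^ (n + 1)) \<subseteq> null_space (U ^ n)}"
proof -
  have "null_space (U ^ n) = null_space (U ^ (n + 1)) \<longleftrightarrow>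
      null_space (U ^ (n + 1)) \<subseteq> null_space (U ^ n)" for n
    using null_space_power_subset[of U n] by blast
  then show ?thesis by (simp only: ascent_def)
qed

text \<open>
  The two ranges are the right ideals generated by \<open>a\<close> and by \<open>b\<close>, so the inclusion says that
  \<open>a\<close> belongs to the second one.
\<close>

lemma range_left_mult_subset_iff:
  "range (op_apply (left_mult a)) \<subseteq> range (op_apply (left_mult b)) \<longleftrightarrow> (\<exists>c. a = b * c)"
proof
  assume "range (op_apply (left_mult a)) \<subseteq> range (op_apply (left_mult b))"
  then have "op_apply (left_mult a) 1 \<in> range (op_apply (left_mult b))" by blast
  then show "\<exists>c. a = b * c" by auto
qed (auto simp: mult.assoc)

lemma range_right_mult_subset_iff:
  "range (op_apply (right_mult a)) \<subseteq> range (op_apply (right_mult b)) \<longleftrightarrow> (\<exists>c. a = c * b)"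
proof
  assume "range (op_apply (right_mult a)) \<subseteq> range (op_apply (right_mult b))"
  then have "op_apply (right_mult a) 1 \<in> range (op_apply (right_mult b))" by blast
  then show "\<exists>c. a = c * b" by auto
qed (auto simp flip: mult.assoc)

lemma rank_one_op_exists:
  fixes x y :: "'h :: complex_hilbert_space"
  shows "\<exists>S. \<forall>z. op_apply S z = cinner z y *\<^sub>C x"
proof -
  have "\<exists>S. op_apply S = (\<lambda>z. cinner z y *\<^sub>C x)"
  proof (rule bounded_op_exists)
    show "norm (cinner z y *\<^sub>C x) \<le> norm z * (norm y * norm x)" for z
      using mult_right_mono[OF Cauchy_Schwarz_cinner[of z y] norm_ge_zero[of x]]
      by (simp add: norm_scaleC mult.assoc)
  qed (simp_all add: cinner_add_left scaleC_add_left cinner_scaleC_left scaleC_scaleC)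
  then show ?thesis by metis
qed

text \<open>
  An operator is annihilated by \<open>left_mult A\<close> iff its range lies in the null space of \<open>A\<close>, and
  every \<open>x\<close> is in the range of a rank one operator whose range consists of multiples of \<open>x\<close>.
\<close>

lemma null_space_left_mult_subset_iff:
  fixes A B :: "'h :: complex_hilbert_space bounded_op"
  shows "null_space (left_mult A) \<subseteq> null_space (left_mult B) \<longleftrightarrow> null_space A \<subseteq> null_space B"
proof
  assume sub: "null_space (left_mult A) \<subseteq> null_space (left_mult B)"
  show "null_space A \<subseteq> null_space B"
  proof
    fix x assume x: "x \<in> null_space A"
    obtain S where S: "\<And>z. op_apply S z = cinner z x *\<^sub>C x"
      using rank_one_op_exists by blast
    have "A * S = 0"
      using x by (intro op_eqI) (simp add: op_apply_mult S op_apply_scaleC null_space_def)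
    then have "B * S = 0"
      using sub by (auto simp: null_space_def)
    then have "cinner x x *\<^sub>C op_apply B x = 0"
      by (metis op_apply_mult S op_apply_scaleC op_apply_zero_left)
    then have "cinner x x = 0 \<or> op_apply B x = 0"
      by (metis norm_eq_zero norm_scaleC mult_eq_0_iff)
    then show "x \<in> null_space B"
      by (auto simp: null_space_def)
  qed
next
  assume "null_space A \<subseteq> null_space B"
  then have "B * S = 0" if "A * S = 0" for S
    using that by (intro op_eqI) (metis (mono_tags, lifting) mem_Collect_eq null_space_def
        op_apply_mult op_apply_zero_left subsetD)
  then show "null_space (left_mult A) \<subseteq> null_space (left_mult B)"
    by (auto simp: null_space_def)
qed

lemma adjoint_op_eq_0_iff [simp]: "adjoint_op S = 0 \<longleftrightarrow> S = 0"
  by (metis adjoint_op_adjoint_op adjoint_op_zero)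

text \<open>
  The equation \<open>S * A = 0\<close> is the adjoint of \<open>adjoint_op A * adjoint_op S = 0\<close>.
\<close>

lemma null_space_right_mult:
  fixes A :: "'h :: complex_hilbert_space bounded_op"
  shows "null_space (right_mult A) = adjoint_op -` null_space (left_mult (adjoint_op A))"
  by (simp add: null_space_def flip: adjoint_op_mult)

lemma descent_left_mult:
  "descent (left_mult A) = descent (A :: 'h :: complex_hilbert_space bounded_op)"
  unfolding descent_eq left_mult_power range_left_mult_subset_iff range_subset_iff_factorization ..

lemma ascent_left_mult:
  "ascent (left_mult A) = ascent (A :: 'h :: complex_hilbert_space bounded_op)"
  unfolding ascent_eq left_mult_power null_space_left_mult_subset_iff ..

lemma descent_right_mult:
  "descent (right_mult A) = descent (adjoint_op (A :: 'h :: complex_hilbert_space bounded_op))"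
proof -
  have "(\<exists>C. S = C * R) \<longleftrightarrow> (\<exists>C. adjoint_op S = adjoint_op R * C)"
    for S R :: "'h bounded_op"
    by (metis adjoint_op_adjoint_op adjoint_op_mult)
  then show ?thesis
    unfolding descent_eq right_mult_power range_right_mult_subset_iff
      range_subset_iff_factorization by (simp only: adjoint_op_power)
qed

lemma ascent_right_mult:
  "ascent (right_mult A) = ascent (adjoint_op (A :: 'h :: complex_hilbert_space bounded_op))"
proof -
  have "null_space (right_mult R) \<subseteq> null_space (right_mult S) \<longleftrightarrow>
      null_space (adjoint_op R) \<subseteq> null_space (adjoint_op S)" for R S :: "'h bounded_op"
  proof -
    have "surj (adjoint_op :: 'h bounded_op \<Rightarrow> _)"
      by (metis adjoint_op_adjoint_op surjI)
    then have "adjoint_op -` X \<subseteq> adjoint_op -` Y \<longleftrightarrow> X \<subseteq> Y" for X Y :: "'h bounded_op set"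
      by (metis image_mono surj_image_vimage_eq vimage_mono)
    then show ?thesis
      by (simp add: null_space_right_mult null_space_left_mult_subset_iff)
  qed
  then show ?thesis
    unfolding ascent_eq right_mult_power by (simp only: adjoint_op_power)
qed

lemma spectra_left_mult:
  fixes T :: "'h :: complex_hilbert_space bounded_op"
  shows "descent_spectrum (left_mult T) = descent_spectrum T"
    and "ascent_spectrum (left_mult T) = ascent_spectrum T"
  by (simp_all add: descent_spectrum_def ascent_spectrum_def left_mult_diff_scalar
      descent_left_mult ascent_left_mult)

lemma spectra_right_mult:
  fixes T :: "'h :: complex_hilbert_space bounded_op"
  shows "descent_spectrum (right_mult T) = cnj ` descent_spectrum (adjoint_op T)"
    and "ascent_spectrum (right_mult T) = cnj ` ascent_spectrum (adjoint_op T)"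
proof -
  have cnj_image: "cnj ` {l. P l} = {l. P (cnj l)}" for P
    by (force intro: image_eqI[where x = "cnj _"])
  show "descent_spectrum (right_mult T) = cnj ` descent_spectrum (adjoint_op T)"
    and "ascent_spectrum (right_mult T) = cnj ` ascent_spectrum (adjoint_op T)"
    by (simp_all add: descent_spectrum_def ascent_spectrum_def right_mult_diff_scalar
        descent_right_mult ascent_right_mult adjoint_op_diff_scalar cnj_image)
qed

section \<open>Self-adjoint operators\<close>

lemma Inf_enat_eq_infinity_iff: "Inf {enat n | n. P n} = \<infinity> \<longleftrightarrow> (\<forall>n. \<not> P n)"
  unfolding top_enat_def[symmetric] Inf_top_conv by (auto simp: top_enat_def)

text \<open>
  With \<open>e = a * c\<close>, the hypotheses give \<open>e = d * a * a * c = d * a\<close>, so \<open>e\<close> is an idempotent that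
  acts on \<open>a\<close> as a unit from both sides, and \<open>d * e = d * a * c\<close> inverts \<open>a\<close> relative to \<open>e\<close>: it is
  the group inverse of \<open>a\<close>.
\<close>

lemma drazin_invertible_if_strongly_regular:
  assumes c: "a = a * a * c" and d: "a = d * a * a"
  shows "drazin_invertible a"
proof -
  define e where "e = a * c"
  have e: "e = d * a"
    unfolding e_def using c d by (metis mult.assoc)
  have ea: "e * a = a" using d e by simp
  have ae: "a * e = a" using c by (simp add: e_def mult.assoc)
  have ee: "e * e = e" using ae e by (simp add: mult.assoc)
  have ab: "a * (d * e) = e"
  proof -
    have "a * (d * e) = a * (d * a) * c" by (simp add: e_def mult.assoc)
    also have "\<dots> = e" using ae e by (simp add: e_def)
    finally show ?thesis .
  qed
  have ba: "d * e * a = e"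
    using ea e by (simp add: mult.assoc)
  have "d * e * a * (d * e) = d * e"
  proof -
    have "d * e * a * (d * e) = d * e * (a * (d * e))" by (simp add: mult.assoc)
    also have "\<dots> = d * e" by (simp add: ab ee mult.assoc)
    finally show ?thesis .
  qed
  moreover have "a ^ 1 * (d * e) * a = a ^ 1" using ab ea by simp
  ultimately show ?thesis
    unfolding drazin_invertible_def using ab ba by metis
qed

text \<open>
  A Drazin inverse \<open>b\<close> commutes with \<open>A\<close>, so \<open>A ^ m * b * A = A ^ m\<close> exhibits \<open>A ^ m\<close> as a right
  multiple of \<open>A ^ (m + 1)\<close>.
\<close>

lemma descent_finite_if_drazin_invertible:
  assumes "drazin_invertible A"
  shows "descent A \<noteq> \<infinity>"
proof -
  obtain b m where b: "A ^ m * b * A = A ^ m" "A * b = b * A"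
    using assms unfolding drazin_invertible_def by blast
  then have "A ^ m = A ^ (m + 1) * b"
    by (metis mult.assoc power_add power_one_right)
  then have "range (op_apply (A ^ m)) \<subseteq> range (op_apply (A ^ (m + 1)))"
    by (metis image_subset_iff op_apply_mult rangeI)
  then show ?thesis
    unfolding descent_eq Inf_enat_eq_infinity_iff by blast
qed

text \<open>
  If \<open>A (A x) = 0\<close>, then \<open>(norm (A x))\<^sup>2 = cinner (A x) (A x) = cinner x (A (A x)) = 0\<close>.
\<close>

lemma selfadjoint_null_space_square:
  fixes A :: "'h :: complex_hilbert_space bounded_op"
  assumes "adjoint_op A = A"
  shows "null_space (A * A) = null_space A"
proof -
  have "op_apply A x = 0" if "op_apply A (op_apply A x) = 0" for x
    using that cinner_adjoint_op[of A x "op_apply A x"] assms by simp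
  then show ?thesis
    by (auto simp: null_space_def op_apply_mult)
qed

lemma selfadjoint_cancel_power:
  fixes A S :: "'h :: complex_hilbert_space bounded_op"
  assumes A: "adjoint_op A = A" and "A ^ n * S = 0"
  shows "A * S = 0"
  using assms(2)
proof (induction n)
  case (Suc n)
  show ?case
  proof (cases n)
    case (Suc k)
    have "A * A * (A ^ k * S) = 0"
      using Suc.prems Suc by (simp add: mult.assoc)
    then have "A * (A ^ k * S) = 0"
      using null_space_left_mult_subset_iff[of "A * A" A] selfadjoint_null_space_square[OF A]
      by (auto simp: null_space_def)
    then show ?thesis
      using Suc.IH Suc by (simp add: mult.assoc)
  qed (use Suc.prems in simp)
qed simp

text \<open>
  Finite descent gives a factorization of \<open>A ^ n\<close> from one side. Self-adjointness is used twice: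
  to reduce the exponent to \<open>1\<close>, and to reflect the resulting equation to the other side.
\<close>

lemma selfadjoint_drazin_if_descent_finite:
  fixes A :: "'h :: complex_hilbert_space bounded_op"
  assumes A: "adjoint_op A = A" and "descent A \<noteq> \<infinity>"
  shows "drazin_invertible A"
proof -
  obtain n where "range (op_apply (A ^ n)) \<subseteq> range (op_apply (A ^ (n + 1)))"
    using assms(2) unfolding descent_eq Inf_enat_eq_infinity_iff by blast
  then obtain C where "A ^ n = A ^ (n + 1) * C"
    unfolding range_subset_iff_factorization by blast
  then have "A ^ n * (1 - A * C) = 0"
    by (simp add: right_diff_distrib power_commutes flip: mult.assoc)
  then have "A * (1 - A * C) = 0"
    by (rule selfadjoint_cancel_power[OF A])
  then have AC: "A = A * A * C"
    by (simp add: right_diff_distrib mult.assoc)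
  then have "A = adjoint_op C * A * A"
    by (metis A adjoint_op_mult mult.assoc)
  with AC show ?thesis
    by (rule drazin_invertible_if_strongly_regular)
qed

lemma selfadjoint_ascent_finite:
  fixes A :: "'h :: complex_hilbert_space bounded_op"
  assumes "adjoint_op A = A"
  shows "ascent A \<noteq> \<infinity>"
proof -
  have "null_space (A ^ (1 + 1)) \<subseteq> null_space (A ^ 1)"
    using selfadjoint_null_space_square[OF assms] by simp
  then show ?thesis
    unfolding ascent_eq Inf_enat_eq_infinity_iff by blast
qed

text \<open>
  As \<open>cinner (T x) x\<close> is real, the imaginary part of \<open>cinner ((T - l *\<^sub>C 1) x) x\<close> is
  \<open>- Im l * (norm x)\<^sup>2\<close>, and Cauchy-Schwarz bounds it by \<open>norm ((T - l *\<^sub>C 1) x) * norm x\<close>.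
\<close>

lemma selfadjoint_lower_bound:
  fixes T :: "'h :: complex_hilbert_space bounded_op"
  assumes T: "adjoint_op T = T"
  shows "\<bar>Im l\<bar> * norm x \<le> norm (op_apply (T - l *\<^sub>C 1) x)"
proof (cases "x = 0")
  case False
  have "Im (cinner (op_apply T x) x) = 0"
    using cinner_adjoint_op[of T x x] cinner_commute[of "op_apply T x" x] T
    by (metis complex_cnj complex.sel(2) cnj.sel(2) equal_neg_zero)
  then have "\<bar>Im (cinner (op_apply (T - l *\<^sub>C 1) x) x)\<bar> = \<bar>Im l\<bar> * norm x * norm x"
    by (simp add: op_apply_diff_left op_apply_scaleC_left op_apply_one cinner_diff_left
        cinner_scaleC_left cinner_norm abs_mult power2_eq_square)
  also have "\<bar>Im (cinner (op_apply (T - l *\<^sub>C 1) x) x)\<bar> \<le> norm (op_apply (T - l *\<^sub>C 1) x) * norm x"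
    using abs_Im_le_cmod Cauchy_Schwarz_cinner order_trans by blast
  ultimately show ?thesis
    using False by simp
qed simp

text \<open>
  The lower bound makes the range closed. A vector orthogonal to the range is in the null space
  of the adjoint \<open>T - cnj l *\<^sub>C 1\<close>, for which the lower bound holds as well; so it is \<open>0\<close>.
\<close>

lemma selfadjoint_nonreal_surj:
  fixes T :: "'h :: complex_hilbert_space bounded_op"
  assumes T: "adjoint_op T = T" and l: "Im l \<noteq> 0"
  shows "range (op_apply (T - l *\<^sub>C 1)) = UNIV"
proof -
  define A where "A = T - l *\<^sub>C 1"
  interpret A: bounded_linear "op_apply A" by (rule bounded_linear_op_apply)
  have "complete (range (op_apply A))"
  proof (rule complete_isometric_image)
    show "0 < \<bar>Im l\<bar>" using l by simp
    show "\<forall>x\<in>UNIV. \<bar>Im l\<bar> * norm x \<le> norm (op_apply A x)"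
      using selfadjoint_lower_bound[OF T] by (simp add: A_def)
  qed (rule subspace_UNIV bounded_linear_op_apply complete_UNIV)+
  then have "closed (range (op_apply A))"
    by (rule complete_imp_closed)
  moreover have "x + y \<in> range (op_apply A)" if "x \<in> range (op_apply A)" "y \<in> range (op_apply A)"
    for x y using that by (auto simp flip: A.add)
  moreover have "c *\<^sub>C x \<in> range (op_apply A)" if "x \<in> range (op_apply A)" for c x
    using that by (auto simp flip: op_apply_scaleC)
  ultimately have proj: "\<exists>m\<in>range (op_apply A). \<forall>z\<in>range (op_apply A). cinner (y - m) z = 0" for y
    by (intro orthogonal_projection_exists) auto
  have "y \<in> range (op_apply A)" for y
  proof -
    obtain m where m: "m \<in> range (op_apply A)" "\<And>x. cinner (y - m) (op_apply A x) = 0"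
      using proj by blast
    have "cinner x (op_apply (T - cnj l *\<^sub>C 1) (y - m)) = 0" for x
    proof -
      have "adjoint_op A = T - cnj l *\<^sub>C 1"
        by (simp add: A_def adjoint_op_diff_scalar T)
      then show ?thesis
        using m(2)[of x] cinner_adjoint_op[of A x "y - m"]
        by (metis cinner_commute complex_cnj_zero)
    qed
    then have "op_apply (T - cnj l *\<^sub>C 1) (y - m) = 0"
      by (intro cinner_ext) simp
    then have "y = m"
      using selfadjoint_lower_bound[OF T, of "cnj l" "y - m"] l
      by (simp add: mult_le_0_iff)
    with m show ?thesis by simp
  qed
  then show ?thesis by (auto simp: A_def)
qed

text \<open>
  Surjectivity of \<open>A = T - l *\<^sub>C 1\<close> gives a bounded right inverse by Douglas' lemma. Its adjoint is
  also surjective, and the adjoint of a right inverse of \<open>adjoint_op A\<close> is a left inverse of \<open>A\<close>.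
\<close>

lemma selfadjoint_nonreal_drazin_invertible:
  fixes T :: "'h :: complex_hilbert_space bounded_op"
  assumes T: "adjoint_op T = T" and l: "Im l \<noteq> 0"
  shows "drazin_invertible (T - l *\<^sub>C 1)"
proof -
  define A where "A = T - l *\<^sub>C 1"
  have adj: "adjoint_op A = T - cnj l *\<^sub>C 1"
    by (simp add: A_def adjoint_op_diff_scalar T)
  obtain C where C: "1 = A * C"
    using Douglas_factorization[of 1 A] selfadjoint_nonreal_surj[OF T l] by (auto simp: A_def)
  obtain D where "1 = adjoint_op A * D"
    using Douglas_factorization[of 1 "adjoint_op A"] selfadjoint_nonreal_surj[OF T, of "cnj l"] l
    unfolding adj by auto
  then have "1 = adjoint_op D * A"
    by (metis adjoint_op_adjoint_op adjoint_op_mult adjoint_op_one)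
  then have "A = adjoint_op D * A * A" by simp
  moreover have "A = A * A * C" using C by (simp add: mult.assoc)
  ultimately show ?thesis
    unfolding A_def[symmetric] by (intro drazin_invertible_if_strongly_regular)
qed

lemma selfadjoint_drazin_spectrum:
  fixes T :: "'h :: complex_hilbert_space bounded_op"
  assumes T: "adjoint_op T = T"
  shows "drazin_spectrum T = descent_spectrum T" "drazin_spectrum T \<subseteq> \<real>"
proof -
  have "drazin_invertible (T - l *\<^sub>C 1) \<longleftrightarrow> descent (T - l *\<^sub>C 1) \<noteq> \<infinity>" for l
  proof (cases "Im l = 0")
    case True
    then have "cnj l = l" by (simp add: complex_eq_iff)
    then have "adjoint_op (T - l *\<^sub>C 1) = T - l *\<^sub>C 1"
      by (simp add: adjoint_op_diff_scalar T)
    then show ?thesis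
      using descent_finite_if_drazin_invertible selfadjoint_drazin_if_descent_finite by blast
  next
    case False
    then show ?thesis
      using selfadjoint_nonreal_drazin_invertible[OF T] descent_finite_if_drazin_invertible
      by blast
  qed
  then show "drazin_spectrum T = descent_spectrum T"
    by (auto simp: drazin_spectrum_def descent_spectrum_def)
  show "drazin_spectrum T \<subseteq> \<real>"
    using selfadjoint_nonreal_drazin_invertible[OF T] complex_is_Real_iff
    unfolding drazin_spectrum_def by blast
qed

lemma selfadjoint_ascent_spectrum_empty:
  fixes T :: "'h :: complex_hilbert_space bounded_op"
  assumes T: "adjoint_op T = T"
  shows "ascent_spectrum T = {}"
proof -
  have "ascent (T - l *\<^sub>C 1) \<noteq> \<infinity>" for l
  proof (cases "Im l = 0")
    case True
    then have "cnj l = l" by (simp add: complex_eq_iff)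
    then show ?thesis
      by (intro selfadjoint_ascent_finite) (simp add: adjoint_op_diff_scalar T)
  next
    case False
    have "op_apply (T - l *\<^sub>C 1) x = 0 \<Longrightarrow> x = 0" for x
      using selfadjoint_lower_bound[OF T, of l x] False by (simp add: mult_le_0_iff)
    then have "null_space ((T - l *\<^sub>C 1) ^ (0 + 1)) \<subseteq> null_space ((T - l *\<^sub>C 1) ^ 0)"
      by (auto simp: null_space_def op_apply_one)
    then show ?thesis
      unfolding ascent_eq Inf_enat_eq_infinity_iff by blast
  qed
  then show ?thesis by (simp add: ascent_spectrum_def)
qed

theorem theorem2p7:
  fixes T :: "'h :: complex_hilbert_space bounded_op"
  shows
    "(descent_spectrum (right_mult T) = cnj ` descent_spectrum (left_mult (adjoint_op T)) \<and>
      cnj ` descent_spectrum (left_mult (adjoint_op T)) = cnj ` descent_spectrum (adjoint_op T) \<and>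
      descent_spectrum (right_mult (adjoint_op T)) = cnj ` descent_spectrum (left_mult T) \<and>
      cnj ` descent_spectrum (left_mult T) = cnj ` descent_spectrum T) \<and>
     (ascent_spectrum (right_mult T) = cnj ` ascent_spectrum (left_mult (adjoint_op T)) \<and>
      cnj ` ascent_spectrum (left_mult (adjoint_op T)) = cnj ` ascent_spectrum (adjoint_op T) \<and>
      ascent_spectrum (right_mult (adjoint_op T)) = cnj ` ascent_spectrum (left_mult T) \<and>
      cnj ` ascent_spectrum (left_mult T) = cnj ` ascent_spectrum T) \<and>
     (T = adjoint_op T \<longrightarrow>
      (descent_spectrum (right_mult T) \<subseteq> \<real> \<and> ascent_spectrum (right_mult T) \<subseteq> \<real>) \<and>
      (ascent_spectrum (right_mult T) = ascent_spectrum (left_mult T) \<and>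
       ascent_spectrum (left_mult T) = ascent_spectrum T) \<and>
      (drazin_spectrum T = descent_spectrum (right_mult T) \<and>
       descent_spectrum (right_mult T) = descent_spectrum (left_mult T) \<and>
       descent_spectrum (left_mult T) = descent_spectrum T))"
proof -
  \<comment> \<open>For self-adjoint \<open>T\<close> the descent spectrum is real, so complex conjugation maps it to itself.\<close>
  have cnj_real: "cnj ` S = S" if "S \<subseteq> \<real>" for S
    using that by (force simp: subset_eq Reals_cnj_iff image_iff)
  show ?thesis
    using spectra_left_mult[of T] spectra_left_mult[of "adjoint_op T"] spectra_right_mult[of T]
      spectra_right_mult[of "adjoint_op T"] selfadjoint_drazin_spectrum[of T]
      selfadjoint_ascent_spectrum_empty[of T] cnj_real[of "descent_spectrum T"]
    by auto
qed

end
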